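(* Let $k>0$ and consider the equation $U_t+U\cdot\nabla_xU=2kJU$, $x\in\mathbb{R}^2$, with initial data $U_0$. The associated flow map, defined by $\dot X_\alpha=\frac{dX_\alpha}{dt}=U(X_\alpha)$, $X_\alpha(0)=\alpha$, and satisfying $\ddot X_\alpha=2kJ\dot X_\alpha$, is given by $$X_\alpha(t)=\frac{1}{2k}J^{-1}e^{2kJt}U_0(\alpha)+\alpha-\frac{1}{2k}J^{-1}U_0(\alpha).$$ If the initial data are sub-critical, i.e. $$4k\,[k-\omega_0(\alpha)]-\Gamma_0(\alpha)>0\qquad\text{for all }\alpha\in\mathbb{R}^2,$$ then this flow map is invertible and is periodic in time with period $\overline{T}=\pi/k$, and the velocity field $U(X_\alpha(t))=U_0(\alpha)+2kJ\,(X_\alpha(t)-\alpha)$ shares the same period $\pi/k$.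
   Context: $U=(u,v)^\top$ is the velocity field on $\mathbb{R}^2$, and $J=\begin{pmatrix}0&1\\ -1&0\end{pmatrix}$. $U(X_\alpha(t))$ is shorthand for $U(t,X_\alpha(t))$. For the initial velocity $U_0=(u_0,v_0)^\top$, with velocity gradient $\nabla_\alpha U_0=\begin{pmatrix}u_{0x}&u_{0y}\\ v_{0x}&v_{0y}\end{pmatrix}$ having eigenvalues $\lambda_1(0),\lambda_2(0)$, the initial vorticity $\omega_0=\nabla\times U_0$ is taken with the sign convention $\omega_0=u_{0y}-v_{0x}$, and $\Gamma_0=(\lambda_2(0)-\lambda_1(0))^2=(u_{0x}+v_{0y})^2-4\det(\nabla_\alpha U_0)$ is the (real-valued) squared initial spectral gap. The flow map at time $t$ is the map $\alpha\mapsto X_\alpha(t)$.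
   Formalization: Sub-criticality alone does not make the flow map onto the plane, so invertible means injective with open image and differentiable inverse there; bijectivity of the plane is claimed when the solution exists on the whole plane over the time interval. Initial data are assumed differentiable. *)

theory Defs
  imports "HOL-Analysis.Analysis"
begin

definition J :: "real^2^2" where
  "J = vector [vector [0, 1], vector [- 1, 0]]"

(* The type real^'n^'n carries the componentwise product, so the library's exp and (^)
   are not the matrix ones. *)
definition mat_exp :: "real^'n^'n \<Rightarrow> real^'n^'n" where
  "mat_exp A = (\<Sum>n. (1 / fact n) *\<^sub>R (((**) A) ^^ n) (mat 1))"

(* Sign convention u_y - v_x, opposite to the usual one. *)
definition vorticity :: "(real^2 \<Rightarrow> real^2) \<Rightarrow> real^2 \<Rightarrow> real" where
  "vorticity V \<alpha> = jacobian V (at \<alpha>) $ 1 $ 2 - jacobian V (at \<alpha>) $ 2 $ 1"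

(* The squared gap between the eigenvalues of the velocity gradient; it is real even when
   the eigenvalues are not, see spectral_gap_sq_eigenvalues. *)
definition spectral_gap_sq :: "(real^2 \<Rightarrow> real^2) \<Rightarrow> real^2 \<Rightarrow> real" where
  "spectral_gap_sq V \<alpha> = (trace (jacobian V (at \<alpha>)))\<^sup>2 - 4 * det (jacobian V (at \<alpha>))"

lemma spectral_gap_sq_eigenvalues:
  fixes l1 l2 :: complex
  assumes "\<And>z. det (mat z - (\<chi> i j. complex_of_real (jacobian V (at \<alpha>) $ i $ j)))
               = (z - l1) * (z - l2)"
  shows "complex_of_real (spectral_gap_sq V \<alpha>) = (l2 - l1)\<^sup>2"
proof -
  define a b c d where "a = complex_of_real (jacobian V (at \<alpha>) $ 1 $ 1)"
    and "b = complex_of_real (jacobian V (at \<alpha>) $ 1 $ 2)"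
    and "c = complex_of_real (jacobian V (at \<alpha>) $ 2 $ 1)"
    and "d = complex_of_real (jacobian V (at \<alpha>) $ 2 $ 2)"
  have char_poly: "(z - a) * (z - d) - b * c = (z - l1) * (z - l2)" for z
    using assms[of z] by (simp add: det_2 mat_def a_def b_def c_def d_def)
  have "a * d - b * c = l1 * l2" using char_poly[of 0] by simp
  moreover have "a + d = l1 + l2"
    using char_poly[of 1] calculation by (simp add: algebra_simps)
  moreover have "complex_of_real (spectral_gap_sq V \<alpha>) = (a + d)\<^sup>2 - 4 * (a * d - b * c)"
    by (simp add: spectral_gap_sq_def det_2 trace_def UNIV_2 a_def b_def c_def d_def)
  ultimately show ?thesis by (simp add: power2_eq_square algebra_simps)
qed

definition subcritical :: "real \<Rightarrow> (real^2 \<Rightarrow> real^2) \<Rightarrow> bool" where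
  "subcritical k U0 \<longleftrightarrow>
     (\<forall>\<alpha>. 4 * k * (k - vorticity U0 \<alpha>) - spectral_gap_sq U0 \<alpha> > 0)"

(* U is a classical solution, with initial data U0, of U_t + (U . grad_x) U = 2kJU on the
   space-time region D. Here Ut is the time derivative of U at (t, x) and A its spatial
   Jacobian matrix, so that A *v U t x is (U . grad_x) U. The derivative is taken within D
   because D need not be a neighbourhood of its points, e.g. at time 0 if D = {0..} \<times> UNIV. *)
definition solves :: "real \<Rightarrow> (real^2 \<Rightarrow> real^2) \<Rightarrow> (real \<times> (real^2)) set
    \<Rightarrow> (real \<Rightarrow> real^2 \<Rightarrow> real^2) \<Rightarrow> bool" where
  "solves k U0 D U \<longleftrightarrow>
     (\<forall>x. (0, x) \<in> D \<and> U 0 x = U0 x) \<and>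
     (\<forall>(t, x) \<in> D. \<exists>Ut A.
        ((\<lambda>(s, y). U s y) has_derivative (\<lambda>(h, w). h *\<^sub>R Ut + A *v w)) (at (t, x) within D) \<and>
        Ut + A *v U t x = (2 * k) *\<^sub>R (J *v U t x))"

definition flow_map :: "real set \<Rightarrow> (real \<times> (real^2)) set \<Rightarrow> (real \<Rightarrow> real^2 \<Rightarrow> real^2)
    \<Rightarrow> (real \<Rightarrow> real^2 \<Rightarrow> real^2) \<Rightarrow> bool" where
  "flow_map I D U X \<longleftrightarrow>
     (\<forall>\<alpha>. X 0 \<alpha> = \<alpha> \<and>
        (\<forall>t\<in>I. (t, X t \<alpha>) \<in> D \<and>
           ((\<lambda>s. X s \<alpha>) has_vector_derivative U t (X t \<alpha>)) (at t within I)))"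

definition explicit_flow :: "real \<Rightarrow> (real^2 \<Rightarrow> real^2) \<Rightarrow> real \<Rightarrow> real^2 \<Rightarrow> real^2" where
  "explicit_flow k U0 t \<alpha> =
     (1 / (2 * k)) *\<^sub>R ((matrix_inv J ** mat_exp ((2 * k * t) *\<^sub>R J)) *v U0 \<alpha>)
     + \<alpha> - (1 / (2 * k)) *\<^sub>R (matrix_inv J *v U0 \<alpha>)"

definition swept_region :: "(real \<Rightarrow> real^2 \<Rightarrow> real^2) \<Rightarrow> (real \<times> (real^2)) set" where
  "swept_region X = {(t, X t \<alpha>) | t \<alpha>. True}"

end

theory Submission
  imports Defs
begin

text \<open>Along particle paths the equation is linear, so the velocity is rotated by $e^{2kJt}$ and paths
  are explicit. If the flow map identified $a \neq b$, or its derivative killed $v \neq 0$, then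
  with $v = b - a$ in the first case and $w$ the corresponding increment of $U_0$ one finds
  $v \cdot Jw = -k |v|^2$. By the mean value theorem along the segment from $a$ to $b$ this
  becomes $v \cdot J A v = -k |v|^2$ for a Jacobian matrix $A$ of $U_0$, i.e. $A - kJ$ has the
  real eigenvector $v$; the discriminant of this quadratic form in $v$ is minus the sub-critical
  quantity.\<close>

section \<open>The matrix \<open>J\<close>, its exponential and rotations\<close>

lemma J_mult_vec_nth [simp]: "(J *v w) $ 1 = w $ 2" "(J *v w) $ 2 = - (w $ 1)"
  by (simp_all add: J_def matrix_vector_mult_def sum_2)

lemma J_J_mult_vec [simp]: "J *v (J *v w) = - w"
  by (simp add: vec_eq_iff forall_2)

lemma matrix_inv_J: "matrix_inv J = - J"
proof -
  have inv: "J ** (- J) = mat 1 \<and> (- J) ** J = mat 1"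
    by (simp add: J_def matrix_matrix_mult_def mat_def vec_eq_iff forall_2 sum_2)
  then have "invertible J"
    unfolding invertible_def by blast
  then have "matrix_inv J ** J = mat 1"
    unfolding matrix_inv_def invertible_def by (rule someI2_ex) simp
  then show ?thesis
    by (metis inv matrix_mul_assoc matrix_mul_lid matrix_mul_rid)
qed

text \<open>Euler's formula with \<open>J\<close> in the role of the imaginary unit, as J^2 = -1.
  The series agree term by term: multiplication by xJ/(n+1) turns the n-th cosine coefficient into
  the next sine coefficient and, up to sign, the n-th sine coefficient into the next cosine
  coefficient.\<close>

lemma mat_exp_J: "mat_exp (x *\<^sub>R J) = cos x *\<^sub>R mat 1 + sin x *\<^sub>R J"
proof -
  have "(1 / fact n) *\<^sub>R (((**) (x *\<^sub>R J)) ^^ n) (mat 1)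
      = (cos_coeff n *\<^sub>R x ^ n) *\<^sub>R mat 1 + (sin_coeff n *\<^sub>R x ^ n) *\<^sub>R J" for n
  proof (induction n)
    case (Suc n)
    let ?P = "(((**) (x *\<^sub>R J)) ^^ n) (mat 1)"
    have "(1 / fact (Suc n)) *\<^sub>R (((**) (x *\<^sub>R J)) ^^ Suc n) (mat 1)
        = (x / real (Suc n)) *\<^sub>R (J ** ((1 / fact n) *\<^sub>R ?P))"
      by (simp add: vec_eq_iff forall_2 matrix_matrix_mult_def sum_2 field_simps)
    also have "\<dots> = (x / real (Suc n)) *\<^sub>R
        ((cos_coeff n *\<^sub>R x ^ n) *\<^sub>R J - (sin_coeff n *\<^sub>R x ^ n) *\<^sub>R mat 1)"
      unfolding Suc.IH by (simp add: vec_eq_iff forall_2 matrix_matrix_mult_def sum_2 mat_def J_def)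
    also have "\<dots> = (cos_coeff (Suc n) *\<^sub>R x ^ Suc n) *\<^sub>R mat 1
        + (sin_coeff (Suc n) *\<^sub>R x ^ Suc n) *\<^sub>R J"
      by (simp add: cos_coeff_Suc sin_coeff_Suc scaleR_diff_right algebra_simps)
    finally show ?case .
  qed (simp add: cos_coeff_def sin_coeff_def)
  then have "(\<lambda>n. (1 / fact n) *\<^sub>R (((**) (x *\<^sub>R J)) ^^ n) (mat 1))
      sums (cos x *\<^sub>R mat 1 + sin x *\<^sub>R J)"
    by (simp only:) (intro sums_add bounded_linear.sums[OF bounded_linear_scaleR_left]
        cos_converges sin_converges)
  then show ?thesis
    unfolding mat_exp_def by (rule sums_unique[symmetric])
qed

text \<open>By \<open>mat_exp_J\<close> this is the action of e^{xJ}, the clockwise rotation by the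
  angle x.\<close>

definition rotation :: "real \<Rightarrow> real^2 \<Rightarrow> real^2" where
  "rotation x w = cos x *\<^sub>R w + sin x *\<^sub>R (J *v w)"

lemma rotation_0 [simp]: "rotation 0 w = w"
  by (simp add: rotation_def)

lemma rotation_minus_rotation [simp]: "rotation (- x) (rotation x w) = w"
proof -
  have "cos x * (cos x * a) + sin x * (sin x * a) = a" for a
    by (simp add: sin_cos_squared_add3 flip: mult.assoc distrib_right)
  then show ?thesis
    by (simp add: rotation_def vec_eq_iff forall_2 distrib_left right_diff_distrib)
qed

lemma rotation_rotation_minus [simp]: "rotation x (rotation (- x) w) = w"
  using rotation_minus_rotation[of "- x" w] by simp

section \<open>The explicit flow and the linear ODE for the velocity\<close>

text \<open>Since J^{-1} = -J, Euler's formula turns J^{-1} e^{2kJt} into sin(2kt) - cos(2kt) J. All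
  later arguments use this form.\<close>

lemma explicit_flow_eq:
  "explicit_flow k U0 t \<alpha> = \<alpha> + (1 / (2 * k)) *\<^sub>R
     (sin (2 * k * t) *\<^sub>R U0 \<alpha> + (1 - cos (2 * k * t)) *\<^sub>R (J *v U0 \<alpha>))"
proof -
  have exp: "(matrix_inv J ** mat_exp ((2 * k * t) *\<^sub>R J)) *v U0 \<alpha>
      = sin (2 * k * t) *\<^sub>R U0 \<alpha> - cos (2 * k * t) *\<^sub>R (J *v U0 \<alpha>)"
    unfolding mat_exp_J matrix_inv_J
    by (simp add: vec_eq_iff forall_2 matrix_vector_mult_def matrix_matrix_mult_def sum_2 mat_def J_def)
  have inv: "matrix_inv J *v U0 \<alpha> = - (J *v U0 \<alpha>)"
    unfolding matrix_inv_J by (simp add: vec_eq_iff forall_2 matrix_vector_mult_def sum_2 J_def)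
  show ?thesis
    unfolding explicit_flow_def exp inv by (simp add: algebra_simps)
qed

lemma explicit_flow_0 [simp]: "explicit_flow k U0 0 \<alpha> = \<alpha>"
  by (simp add: explicit_flow_eq)

lemma explicit_flow_periodic:
  assumes "k \<noteq> 0"
  shows "explicit_flow k U0 (t + pi / k) = explicit_flow k U0 t"
proof -
  have "2 * k * (t + pi / k) = 2 * k * t + 2 * pi"
    using assms by (simp add: field_simps)
  then show ?thesis
    by (simp add: fun_eq_iff explicit_flow_eq)
qed

lemma explicit_flow_velocity:
  assumes "k \<noteq> 0"
  shows "U0 \<alpha> + (2 * k) *\<^sub>R (J *v (explicit_flow k U0 t \<alpha> - \<alpha>)) = rotation (2 * k * t) (U0 \<alpha>)"
  using assms
  by (simp add: explicit_flow_eq rotation_def matrix_vector_mult_scaleR matrix_vector_right_distrib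
      matrix_vector_mult_diff_distrib scaleR_left_diff_distrib)

lemma has_vector_derivative_explicit_flow:
  assumes "k \<noteq> 0"
  shows "((\<lambda>t. explicit_flow k U0 t \<alpha>) has_vector_derivative rotation (2 * k * t) (U0 \<alpha>))
    (at t within S)"
  unfolding explicit_flow_eq rotation_def using assms
  by (auto intro!: derivative_eq_intros simp: scaleR_right_distrib)

text \<open>Integrating factor: rotating V back by the angle cs gives a curve \<open>Z\<close> with
  zero derivative, which is constant because S is convex.\<close>

lemma rotation_ode_unique:
  assumes "convex S" "0 \<in> S" "t \<in> S"
    and V: "\<And>s. s \<in> S \<Longrightarrow> (V has_vector_derivative c *\<^sub>R (J *v V s)) (at s within S)"
  shows "V t = rotation (c * t) (V 0)"
proof -
  define Z where "Z s = rotation (- (c * s)) (V s)" for s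
  have JV: "((\<lambda>s. J *v V s) has_vector_derivative J *v (c *\<^sub>R (J *v V s))) (at s within S)"
    if "s \<in> S" for s
    by (rule bounded_linear.has_vector_derivative[OF matrix_vector_mul_bounded_linear V[OF that]])
  have "(Z has_vector_derivative 0) (at s within S)" if "s \<in> S" for s
    unfolding Z_def rotation_def
    by (rule derivative_eq_intros V[OF that] JV[OF that] refl | simp)+
      (simp add: vec_eq_iff forall_2 algebra_simps)
  then have "(Z has_derivative (\<lambda>h. 0)) (at s within S)" if "s \<in> S" for s
    using that by (simp add: has_vector_derivative_def)
  then have "\<exists>C. \<forall>s\<in>S. Z s = C"
    by (intro has_derivative_zero_constant assms) auto
  then have "Z t = Z 0"
    using assms by auto
  then show ?thesis
    by (metis Z_def mult_zero_right neg_equal_0_iff_equal rotation_0 rotation_rotation_minus)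
qed

section \<open>Injectivity of the flow map from sub-criticality\<close>

text \<open>With s = sin x and m = 1 - cos x the hypothesis reads 2kv = -(sw + mJw). Pairing it with
  Jw gives 2k v.Jw = -m|w|^2. Taking squared norms gives 4k^2|v|^2 = (s^2 + m^2)|w|^2 = 2m|w|^2.
  Eliminating m|w|^2 removes both x and w from the right-hand side, so a single condition on the
  data serves all times.\<close>

lemma flow_increment_eq_0D:
  assumes "k \<noteq> 0" and "v + (1 / (2 * k)) *\<^sub>R (sin x *\<^sub>R w + (1 - cos x) *\<^sub>R (J *v w)) = 0"
  shows "v \<bullet> (J *v w) = - k * (v \<bullet> v)"
proof -
  define s m where "s = sin x" and "m = 1 - cos x"
  have "(2 * k) *\<^sub>R (v + (1 / (2 * k)) *\<^sub>R (s *\<^sub>R w + m *\<^sub>R (J *v w))) = 0"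
    using assms by (simp add: s_def m_def)
  then have "(2 * k) *\<^sub>R v + (s *\<^sub>R w + m *\<^sub>R (J *v w)) = 0"
    using \<open>k \<noteq> 0\<close> by (simp only: scaleR_right_distrib[of _ v]) simp
  then have v1: "2 * k * v $ 1 = - (s * w $ 1 + m * w $ 2)"
    and v2: "2 * k * v $ 2 = - (s * w $ 2 - m * w $ 1)"
    by (auto simp: vec_eq_iff forall_2)
  have "s\<^sup>2 + (1 - m)\<^sup>2 = 1"
    by (simp add: s_def m_def)
  then have sm: "s * s + m * m = 2 * m"
    by (simp add: power2_eq_square algebra_simps)
  have "2 * k * (v \<bullet> (J *v w)) = (2 * k * v $ 1) * w $ 2 - (2 * k * v $ 2) * w $ 1"
    by (simp add: inner_vec_def sum_2 algebra_simps)
  also have "\<dots> = - m * (w \<bullet> w)"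
    unfolding v1 v2 by (simp add: inner_vec_def sum_2 algebra_simps)
  finally have d: "2 * k * (v \<bullet> (J *v w)) = - m * (w \<bullet> w)" .
  have "(2 * k) * (2 * k) * (v \<bullet> v) = (2 * k * v $ 1) * (2 * k * v $ 1) + (2 * k * v $ 2) * (2 * k * v $ 2)"
    by (simp add: inner_vec_def sum_2 algebra_simps)
  also have "\<dots> = (s * s + m * m) * (w \<bullet> w)"
    unfolding v1 v2 by (simp add: inner_vec_def sum_2 algebra_simps)
  finally have "(2 * k) * (2 * k) * (v \<bullet> v) = 2 * m * (w \<bullet> w)"
    unfolding sm .
  then have "2 * k * (2 * (v \<bullet> (J *v w)) + 2 * k * (v \<bullet> v)) = 0"
    using d by (simp add: algebra_simps)
  then show ?thesis
    using \<open>k \<noteq> 0\<close> by simp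
qed

text \<open>In the plane v.Jy is the determinant with columns v and y. With A the Jacobian matrix,
  the excluded equation is v.J(A - kJ)v = 0, so it says that (A - kJ)v is parallel to v.\<close>

lemma subcritical_no_real_eigenvector:
  assumes "subcritical k U0" "v \<noteq> 0"
  shows "v \<bullet> (J *v (jacobian U0 (at \<alpha>) *v v)) \<noteq> - k * (v \<bullet> v)"
proof
  assume eq: "v \<bullet> (J *v (jacobian U0 (at \<alpha>) *v v)) = - k * (v \<bullet> v)"
  define A where "A = jacobian U0 (at \<alpha>)"
  \<comment> \<open>The coefficients of v.JAv + k|v|^2 as a quadratic form in the two components of
    v.\<close>
  define a b c where "a = A $ 2 $ 1 + k" and "b = A $ 2 $ 2 - A $ 1 $ 1" and "c = k - A $ 1 $ 2"
  have "4 * k * (k - vorticity U0 \<alpha>) - spectral_gap_sq U0 \<alpha> > 0"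
    using assms by (simp add: subcritical_def)
  moreover have "4 * a * c - b * b = 4 * k * (k - vorticity U0 \<alpha>) - spectral_gap_sq U0 \<alpha>"
    unfolding vorticity_def spectral_gap_sq_def trace_def det_2 sum_2 a_def b_def c_def A_def by algebra
  ultimately have disc: "4 * a * c - b * b > 0"
    by simp
  have form: "a * v $ 1 * v $ 1 + b * v $ 1 * v $ 2 + c * v $ 2 * v $ 2 = 0"
    using eq unfolding inner_vec_def sum_2 J_mult_vec_nth inner_real_def
    by (simp add: sum_2 matrix_vector_mult_def a_def b_def c_def A_def algebra_simps)
  \<comment> \<open>Completing the square, scaled by 4a to avoid dividing by a. As 4ac - b^2 > 0,
    both summands on the left are nonnegative, so both vanish once the form does.\<close>
  have "(2 * a * v $ 1 + b * v $ 2)\<^sup>2 + (4 * a * c - b * b) * (v $ 2)\<^sup>2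
      = 4 * a * (a * v $ 1 * v $ 1 + b * v $ 1 * v $ 2 + c * v $ 2 * v $ 2)"
    by (simp add: power2_eq_square algebra_simps)
  then have "(2 * a * v $ 1 + b * v $ 2)\<^sup>2 + (4 * a * c - b * b) * (v $ 2)\<^sup>2 = 0"
    unfolding form by simp
  moreover have "(4 * a * c - b * b) * (v $ 2)\<^sup>2 \<ge> 0"
    using disc by simp
  ultimately have "(4 * a * c - b * b) * (v $ 2)\<^sup>2 = 0"
    by (smt (verit) zero_le_power2)
  then have v2: "v $ 2 = 0"
    using disc by simp
  moreover have "a \<noteq> 0"
    using disc zero_le_square[of b] by auto
  ultimately have "v $ 1 = 0"
    using form by simp
  with v2 show False
    using \<open>v \<noteq> 0\<close> by (simp add: vec_eq_iff forall_2)
qed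

text \<open>Invertible derivatives alone would only be a local condition. Here the secant between
  two points with the same image is reduced to one Jacobian on the segment joining them.\<close>

lemma inj_explicit_flow:
  assumes "k \<noteq> 0" and diff: "\<And>\<alpha>. U0 differentiable (at \<alpha>)" and "subcritical k U0"
  shows "inj (explicit_flow k U0 t)"
proof (rule injI, rule ccontr)
  fix a b
  assume eq: "explicit_flow k U0 t a = explicit_flow k U0 t b" and "a \<noteq> b"
  define v where "v = b - a"
  have "v \<noteq> 0"
    using \<open>a \<noteq> b\<close> by (simp add: v_def)
  \<comment> \<open>The mean value theorem with equality holds for real-valued functions only, hence
    the pairing of J U0 with the fixed vector v before differentiating along the segment.\<close>
  define f where "f s = v \<bullet> (J *v U0 (a + s *\<^sub>R v))" for s
  have U0: "(U0 has_derivative (*v) (jacobian U0 (at x))) (at x)" for x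
    using diff jacobian_works by blast
  have line: "((\<lambda>s. U0 (a + s *\<^sub>R v)) has_derivative
      (\<lambda>h. jacobian U0 (at (a + s *\<^sub>R v)) *v (h *\<^sub>R v))) (at s)" for s
    by (rule has_derivative_compose[OF _ U0]) (auto intro!: derivative_eq_intros)
  have f: "(f has_derivative (\<lambda>h. v \<bullet> (J *v (jacobian U0 (at (a + s *\<^sub>R v)) *v (h *\<^sub>R v))))) (at s)" for s
    unfolding f_def
    by (intro bounded_linear.has_derivative[OF bounded_linear_inner_right]
        bounded_linear.has_derivative[OF matrix_vector_mul_bounded_linear] line)
  obtain s where "f 1 - f 0 = v \<bullet> (J *v (jacobian U0 (at (a + s *\<^sub>R v)) *v ((1 - 0) *\<^sub>R v)))"
    using mvt_simple[of 0 1 f, OF _ has_derivative_at_withinI[OF f]] by auto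
  moreover have "f 1 - f 0 = v \<bullet> (J *v (U0 b - U0 a))"
    by (simp add: f_def v_def matrix_vector_mult_diff_distrib inner_diff_right)
  moreover have "v \<bullet> (J *v (U0 b - U0 a)) = - k * (v \<bullet> v)"
  \<comment> \<open>The flow increment lemma is applied with w = U0(b) - U0(a), a finite difference
    rather than a derivative.\<close>
  proof (rule flow_increment_eq_0D[OF \<open>k \<noteq> 0\<close>])
    have "v + (1 / (2 * k)) *\<^sub>R (sin (2 * k * t) *\<^sub>R (U0 b - U0 a)
        + (1 - cos (2 * k * t)) *\<^sub>R (J *v (U0 b - U0 a)))
      = explicit_flow k U0 t b - explicit_flow k U0 t a"
      unfolding explicit_flow_eq v_def matrix_vector_mult_diff_distrib
      by (simp only: scaleR_right_distrib scaleR_right_diff_distrib) simp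
    then show "v + (1 / (2 * k)) *\<^sub>R (sin (2 * k * t) *\<^sub>R (U0 b - U0 a)
        + (1 - cos (2 * k * t)) *\<^sub>R (J *v (U0 b - U0 a))) = 0"
      using eq by simp
  qed
  ultimately show False
    using subcritical_no_real_eigenvector[OF \<open>subcritical k U0\<close> \<open>v \<noteq> 0\<close>, of "a + s *\<^sub>R v"]
    by simp
qed

section \<open>Differentiability of the inverse\<close>

text \<open>An inverse function theorem without continuity of the derivative: global injectivity and
  invariance of domain take its place. The identity for g' makes the derivative of the inverse
  computable on images under \<open>f' x\<close>.\<close>

lemma inj_has_derivative_inv:
  fixes f :: "'a::euclidean_space \<Rightarrow> 'a"
  assumes "inj f" and f': "\<And>x. (f has_derivative f' x) (at x)" and inj': "\<And>x. inj (f' x)"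
  shows "open (range f)"
    and "\<exists>g'. (inv f has_derivative g') (at (f x)) \<and> g' \<circ> f' x = id"
proof -
  have cont: "continuous_on UNIV f"
    using f' by (meson continuous_at_imp_continuous_on has_derivative_continuous)
  then show "open (range f)"
    using \<open>inj f\<close> by (intro invariance_of_domain) auto
  have "linear (f' x)"
    using f' has_derivative_linear by blast
  then obtain g' where "linear g'" "\<forall>y. g' (f' x y) = y" "\<forall>y. f' x (g' y) = y"
    using linear_injective_isomorphism[OF _ inj'] by metis
  then have g': "f' x \<circ> g' = id" "g' \<circ> f' x = id"
    by auto
  have "(inv f has_derivative g') (at (f x))"
    by (rule has_derivative_inverse_strong[OF open_UNIV _ cont _ f' g'(1)]) (auto simp: \<open>inj f\<close>)
  with g' show "\<exists>g'. (inv f has_derivative g') (at (f x)) \<and> g' \<circ> f' x = id"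
    by blast
qed

lemma has_derivative_explicit_flow:
  assumes "U0 differentiable (at \<alpha>)"
  shows "(explicit_flow k U0 t has_derivative
     (\<lambda>w. w + (1 / (2 * k)) *\<^sub>R (sin (2 * k * t) *\<^sub>R (jacobian U0 (at \<alpha>) *v w)
        + (1 - cos (2 * k * t)) *\<^sub>R (J *v (jacobian U0 (at \<alpha>) *v w))))) (at \<alpha>)"
proof -
  have U0: "(U0 has_derivative (*v) (jacobian U0 (at \<alpha>))) (at \<alpha>)"
    using assms jacobian_works by blast
  show ?thesis
    unfolding explicit_flow_eq[abs_def]
    by (intro has_derivative_add has_derivative_ident has_derivative_scaleR_right U0
        bounded_linear.has_derivative[OF matrix_vector_mul_bounded_linear])
qed

text \<open>Infinitesimal counterpart of \<open>inj_explicit_flow\<close>: a kernel vector v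
  satisfies the hypothesis of \<open>flow_increment_eq_0D\<close> with w the Jacobian applied to
  v.\<close>

lemma inj_derivative_explicit_flow:
  assumes "k \<noteq> 0" "subcritical k U0"
  shows "inj (\<lambda>w. w + (1 / (2 * k)) *\<^sub>R (sin x *\<^sub>R (jacobian U0 (at \<alpha>) *v w)
        + (1 - cos x) *\<^sub>R (J *v (jacobian U0 (at \<alpha>) *v w))))"
    (is "inj ?L")
proof -
  have "linear ?L"
  proof (rule linearI)
    show "?L (v + w) = ?L v + ?L w" for v w
      by (simp only: matrix_vector_right_distrib scaleR_right_distrib add.assoc add.commute add.left_commute)
    show "?L (r *\<^sub>R v) = r *\<^sub>R ?L v" for r v
      by (simp only: matrix_vector_mult_scaleR scaleR_right_distrib scaleR_left_commute)
  qed
  moreover have "v = 0" if "?L v = 0" for v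
    using flow_increment_eq_0D[OF \<open>k \<noteq> 0\<close> that] subcritical_no_real_eigenvector[OF assms(2)] by blast
  ultimately show ?thesis
    using linear_injective_0[of ?L] by blast
qed

section \<open>The space-time flow and existence of a solution\<close>

text \<open>The solution is built as the velocity in the coordinates (t, \<alpha>) composed with the
  inverse of (t, \<alpha>) -> (t, X). Both maps are therefore differentiated jointly in time and
  label.\<close>

lemma has_derivative_spacetime:
  fixes U0 :: "real^2 \<Rightarrow> real^2"
  assumes "U0 differentiable (at \<alpha>)" and "k \<noteq> 0"
  shows has_derivative_rotation_spacetime:
      "((\<lambda>(t, \<alpha>). rotation (2 * k * t) (U0 \<alpha>)) has_derivative
        (\<lambda>(h, w). h *\<^sub>R ((2 * k) *\<^sub>R (J *v rotation (2 * k * t) (U0 \<alpha>)))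
           + rotation (2 * k * t) (jacobian U0 (at \<alpha>) *v w))) (at (t, \<alpha>))"
    and has_derivative_explicit_flow_spacetime:
      "((\<lambda>(t, \<alpha>). (t, explicit_flow k U0 t \<alpha>)) has_derivative
        (\<lambda>(h, w). (h, h *\<^sub>R rotation (2 * k * t) (U0 \<alpha>)
           + (w + (1 / (2 * k)) *\<^sub>R (sin (2 * k * t) *\<^sub>R (jacobian U0 (at \<alpha>) *v w)
              + (1 - cos (2 * k * t)) *\<^sub>R (J *v (jacobian U0 (at \<alpha>) *v w))))))) (at (t, \<alpha>))"
proof -
  let ?A = "jacobian U0 (at \<alpha>)"
  have "(U0 has_derivative (*v) ?A) (at \<alpha>)"
    using assms jacobian_works by blast
  then have U0: "((\<lambda>p. U0 (snd p)) has_derivative (\<lambda>p. ?A *v snd p)) (at (t, \<alpha>))"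
    by (intro has_derivative_compose[OF has_derivative_snd[OF has_derivative_ident]]) simp
  note J0 = bounded_linear.has_derivative[OF matrix_vector_mul_bounded_linear[of J] U0]
  show "((\<lambda>(t, \<alpha>). rotation (2 * k * t) (U0 \<alpha>)) has_derivative
        (\<lambda>(h, w). h *\<^sub>R ((2 * k) *\<^sub>R (J *v rotation (2 * k * t) (U0 \<alpha>)))
           + rotation (2 * k * t) (?A *v w))) (at (t, \<alpha>))"
    unfolding rotation_def case_prod_unfold
    by (rule derivative_eq_intros U0 J0 refl | simp)+
      (simp add: fun_eq_iff vec_eq_iff forall_2 algebra_simps)
  show "((\<lambda>(t, \<alpha>). (t, explicit_flow k U0 t \<alpha>)) has_derivative
        (\<lambda>(h, w). (h, h *\<^sub>R rotation (2 * k * t) (U0 \<alpha>)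
           + (w + (1 / (2 * k)) *\<^sub>R (sin (2 * k * t) *\<^sub>R (?A *v w)
              + (1 - cos (2 * k * t)) *\<^sub>R (J *v (?A *v w))))))) (at (t, \<alpha>))"
    unfolding rotation_def explicit_flow_eq case_prod_unfold
    by (rule derivative_eq_intros U0 J0 refl | simp)+
      (use \<open>k \<noteq> 0\<close> in \<open>simp add: fun_eq_iff vec_eq_iff forall_2 field_simps\<close>)
qed

lemma swept_region_eq_range: "swept_region X = range (\<lambda>(t, \<alpha>). (t, X t \<alpha>))"
  unfolding swept_region_def by force

text \<open>The last claim expresses that labels are constant along particle paths: the space-time
  flow sends the pure time direction (1, 0) to the path direction (1, velocity), and the derivative
  of its inverse sends it back.\<close>

lemma explicit_flow_spacetime_inverse:
  fixes k :: real and U0 :: "real^2 \<Rightarrow> real^2"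
  defines "\<Phi> \<equiv> \<lambda>(t, \<alpha>). (t, explicit_flow k U0 t \<alpha>)"
  assumes "k \<noteq> 0" and diff: "\<And>\<alpha>. U0 differentiable (at \<alpha>)" and "subcritical k U0"
  shows "inj \<Phi>" and "open (range \<Phi>)"
    and "\<exists>\<Psi>. (inv \<Phi> has_derivative \<Psi>) (at (t, explicit_flow k U0 t \<alpha>)) \<and>
      \<Psi> (1, rotation (2 * k * t) (U0 \<alpha>)) = (1, 0)"
proof -
  define L where "L = (\<lambda>(t, \<alpha>) w. w + (1 / (2 * k)) *\<^sub>R (sin (2 * k * t) *\<^sub>R (jacobian U0 (at \<alpha>) *v w)
      + (1 - cos (2 * k * t)) *\<^sub>R (J *v (jacobian U0 (at \<alpha>) *v w))))"
  define \<Phi>' where "\<Phi>' = (\<lambda>(t, \<alpha>) (h, w). (h, h *\<^sub>R rotation (2 * k * t) (U0 \<alpha>) + L (t, \<alpha>) w))"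
  have der: "(\<Phi> has_derivative \<Phi>' p) (at p)" for p
    unfolding \<Phi>_def \<Phi>'_def L_def
    using has_derivative_explicit_flow_spacetime[OF diff \<open>k \<noteq> 0\<close>] by (cases p) simp
  have "inj (L p)" for p
    unfolding L_def using inj_derivative_explicit_flow[OF \<open>k \<noteq> 0\<close> \<open>subcritical k U0\<close>]
    by (cases p) simp
  \<comment> \<open>The derivative is block triangular with identity time block, so injectivity
    reduces to the spatial block \<open>L p\<close>.\<close>
  then have inj': "inj (\<Phi>' p)" for p
    unfolding inj_def \<Phi>'_def by (cases p) simp
  show inj: "inj \<Phi>"
    using inj_explicit_flow[OF \<open>k \<noteq> 0\<close> diff \<open>subcritical k U0\<close>]
    by (auto simp: inj_def \<Phi>_def)
  note inv = inj_has_derivative_inv[OF inj der inj']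
  show "open (range \<Phi>)"
    by (rule inv(1))
  obtain \<Psi> where \<Psi>: "(inv \<Phi> has_derivative \<Psi>) (at (\<Phi> (t, \<alpha>)))" "\<Psi> \<circ> \<Phi>' (t, \<alpha>) = id"
    using inv(2) by blast
  have "\<Phi>' (t, \<alpha>) (1, 0) = (1, rotation (2 * k * t) (U0 \<alpha>))"
    by (simp add: \<Phi>'_def L_def)
  then have "\<Psi> (1, rotation (2 * k * t) (U0 \<alpha>)) = (1, 0)"
    using fun_cong[OF \<Psi>(2), of "(1, 0)"] by simp
  then show "\<exists>\<Psi>. (inv \<Phi> has_derivative \<Psi>) (at (t, explicit_flow k U0 t \<alpha>)) \<and>
      \<Psi> (1, rotation (2 * k * t) (U0 \<alpha>)) = (1, 0)"
    using \<Psi>(1) by (auto simp: \<Phi>_def)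
qed

lemma subcritical_solution_exists:
  assumes "k \<noteq> 0" and diff: "\<And>\<alpha>. U0 differentiable (at \<alpha>)" and "subcritical k U0"
  obtains U where "solves k U0 (swept_region (explicit_flow k U0)) U"
    and "\<And>t \<alpha>. U t (explicit_flow k U0 t \<alpha>) = rotation (2 * k * t) (U0 \<alpha>)"
proof -
  define \<Phi> where "\<Phi> = (\<lambda>(t, \<alpha>). (t, explicit_flow k U0 t \<alpha>))"
  define G where "G = (\<lambda>(t, \<alpha>). rotation (2 * k * t) (U0 \<alpha>))"
  \<comment> \<open>Off the range of \<open>\<Phi>\<close> the value of \<open>inv\<close> is
    unspecified. The range is open, so derivatives at its points do not see those values.\<close>
  define U where "U = (\<lambda>t x. G (inv \<Phi> (t, x)))"
  note \<Phi> = explicit_flow_spacetime_inverse[OF assms, folded \<Phi>_def]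
  have inv: "inv \<Phi> (t, explicit_flow k U0 t \<alpha>) = (t, \<alpha>)" for t \<alpha>
    using inv_f_f[OF \<Phi>(1), of "(t, \<alpha>)"] by (simp add: \<Phi>_def)
  have U: "U t (explicit_flow k U0 t \<alpha>) = rotation (2 * k * t) (U0 \<alpha>)" for t \<alpha>
    by (simp add: U_def inv G_def)
  have "\<exists>Ut A. ((\<lambda>(s, y). U s y) has_derivative (\<lambda>(h, w). h *\<^sub>R Ut + A *v w))
        (at (t, explicit_flow k U0 t \<alpha>) within D) \<and>
      Ut + A *v U t (explicit_flow k U0 t \<alpha>) = (2 * k) *\<^sub>R (J *v U t (explicit_flow k U0 t \<alpha>))"
    for t \<alpha> D
  proof -
    obtain \<Psi> where \<Psi>: "(inv \<Phi> has_derivative \<Psi>) (at (t, explicit_flow k U0 t \<alpha>))"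
      "\<Psi> (1, rotation (2 * k * t) (U0 \<alpha>)) = (1, 0)"
      using \<Phi>(3) by blast
    define G' where "G' = (\<lambda>(h, w). h *\<^sub>R ((2 * k) *\<^sub>R (J *v rotation (2 * k * t) (U0 \<alpha>)))
           + rotation (2 * k * t) (jacobian U0 (at \<alpha>) *v w))"
    have "(G has_derivative G') (at (inv \<Phi> (t, explicit_flow k U0 t \<alpha>)))"
      unfolding inv G_def G'_def by (rule has_derivative_rotation_spacetime[OF diff \<open>k \<noteq> 0\<close>])
    then have der: "((\<lambda>(s, y). U s y) has_derivative (\<lambda>q. G' (\<Psi> q)))
        (at (t, explicit_flow k U0 t \<alpha>))"
      using has_derivative_compose[OF \<Psi>(1)] by (simp add: U_def case_prod_unfold)
    have lin: "linear (\<lambda>q. G' (\<Psi> q))"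
      using der has_derivative_linear by blast
    have "linear (\<lambda>w :: real^2. (0 :: real, w))"
      by (rule linearI) auto
    then have lin2: "linear (\<lambda>w. G' (\<Psi> (0, w)))"
      using linear_compose[OF _ lin, of "\<lambda>w. (0, w)"] by (simp add: o_def)
    \<comment> \<open>The time and space parts of the full derivative of U.\<close>
    define Ut A where "Ut = G' (\<Psi> (1, 0))" and "A = matrix (\<lambda>w. G' (\<Psi> (0, w)))"
    have split: "G' (\<Psi> (h, w)) = h *\<^sub>R Ut + A *v w" for h w
    proof -
      have "G' (\<Psi> (h *\<^sub>R (1, 0) + (0, w))) = h *\<^sub>R Ut + A *v w"
        unfolding Ut_def A_def
        using matrix_works[of "\<lambda>w. G' (\<Psi> (0, w))"] lin2
        by (simp only: linear_add[OF lin] linear_cmul[OF lin] linear_matrix_vector_mul_eq)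
      then show ?thesis by simp
    qed
    \<comment> \<open>The left-hand side is the derivative of U in the path direction (1, U). Since
      \<open>\<Psi>\<close> maps that direction to (1, 0), only the time derivative of the rotation
      at fixed label remains.\<close>
    have "Ut + A *v rotation (2 * k * t) (U0 \<alpha>) = G' (1, 0)"
      using split[of 1 "rotation (2 * k * t) (U0 \<alpha>)"] \<Psi>(2) by simp
    also have "\<dots> = (2 * k) *\<^sub>R (J *v rotation (2 * k * t) (U0 \<alpha>))"
      by (simp add: G'_def rotation_def)
    finally show ?thesis
      unfolding U using has_derivative_at_withinI[OF der, of D]
      by (intro exI[of _ Ut] exI[of _ A]) (simp add: case_prod_unfold flip: split)
  qed
  moreover have "(0, x) \<in> swept_region (explicit_flow k U0)" for x
    unfolding swept_region_def using explicit_flow_0[of k U0 x, symmetric] by blast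
  moreover have "U 0 x = U0 x" for x
    using U[of 0 x] by simp
  ultimately have "solves k U0 (swept_region (explicit_flow k U0)) U"
    unfolding solves_def swept_region_def by auto
  then show thesis
    using U by (rule that)
qed

section \<open>Arbitrary solutions and their flow maps\<close>

text \<open>Chain rule: as the path moves with velocity U, the left-hand side of the equation is the
  time derivative of U along the path. The path stays in D, so a derivative within D
  suffices.\<close>

lemma has_vector_derivative_along_flow:
  assumes "solves k U0 D U" "flow_map I D U X" "t \<in> I"
  shows "((\<lambda>s. U s (X s \<alpha>)) has_vector_derivative (2 * k) *\<^sub>R (J *v U t (X t \<alpha>))) (at t within I)"
proof -
  have X: "((\<lambda>s. X s \<alpha>) has_vector_derivative U t (X t \<alpha>)) (at t within I)"
    and D: "(\<lambda>s. (s, X s \<alpha>)) ` I \<subseteq> D"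
    using assms by (auto simp: flow_map_def)
  then obtain Ut A where
    A: "((\<lambda>(s, y). U s y) has_derivative (\<lambda>(h, w). h *\<^sub>R Ut + A *v w)) (at (t, X t \<alpha>) within D)"
      "Ut + A *v U t (X t \<alpha>) = (2 * k) *\<^sub>R (J *v U t (X t \<alpha>))"
    using assms unfolding solves_def by blast
  have "((\<lambda>s. (s, X s \<alpha>)) has_derivative (\<lambda>h. (h, h *\<^sub>R U t (X t \<alpha>)))) (at t within I)"
    using X by (intro has_derivative_Pair has_derivative_ident) (simp add: has_vector_derivative_def)
  from has_derivative_in_compose[OF this has_derivative_subset[OF A(1) D]]
  show ?thesis
    by (simp add: has_vector_derivative_def matrix_vector_mult_scaleR flip: A(2) scaleR_right_distrib)
qed

text \<open>The velocity along a path solves V' = 2kJV, hence is a rotation of its initial value.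
  Then X and the explicit flow have the same time derivative and the same starting point.\<close>

lemma flow_map_explicit:
  assumes "k \<noteq> 0" "is_interval I" "0 \<in> I" "t \<in> I" and sol: "solves k U0 D U" and flow: "flow_map I D U X"
  shows flow_map_velocity: "U t (X t \<alpha>) = rotation (2 * k * t) (U0 \<alpha>)"
    and flow_map_eq_explicit_flow: "X t \<alpha> = explicit_flow k U0 t \<alpha>"
proof -
  have "convex I"
    using \<open>is_interval I\<close> by (rule is_interval_convex)
  have X0: "X 0 \<alpha> = \<alpha>"
    using flow by (simp add: flow_map_def)
  have vel: "U s (X s \<alpha>) = rotation (2 * k * s) (U0 \<alpha>)" if "s \<in> I" for s
    using rotation_ode_unique[OF \<open>convex I\<close> \<open>0 \<in> I\<close> that has_vector_derivative_along_flow[OF sol flow]]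
      X0 sol by (simp add: solves_def)
  then show "U t (X t \<alpha>) = rotation (2 * k * t) (U0 \<alpha>)"
    using \<open>t \<in> I\<close> .
  have "((\<lambda>s. X s \<alpha> - explicit_flow k U0 s \<alpha>) has_vector_derivative 0) (at s within I)" if "s \<in> I" for s
  proof -
    have "((\<lambda>s. X s \<alpha>) has_vector_derivative rotation (2 * k * s) (U0 \<alpha>)) (at s within I)"
      using flow that by (simp add: flow_map_def flip: vel)
    from has_vector_derivative_diff[OF this
        has_vector_derivative_explicit_flow[OF \<open>k \<noteq> 0\<close>, where ?U0.0 = U0 and \<alpha> = \<alpha>]]
    show ?thesis by simp
  qed
  then have "\<exists>C. \<forall>s\<in>I. X s \<alpha> - explicit_flow k U0 s \<alpha> = C"
    by (intro has_derivative_zero_constant \<open>convex I\<close>) (simp add: has_vector_derivative_def)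
  then have "X t \<alpha> - explicit_flow k U0 t \<alpha> = X 0 \<alpha> - explicit_flow k U0 0 \<alpha>"
    using \<open>t \<in> I\<close> \<open>0 \<in> I\<close> by metis
  then show "X t \<alpha> = explicit_flow k U0 t \<alpha>"
    using X0 by simp
qed

text \<open>The range of the flow map is closed because the velocity at an image point determines
  its preimage, which therefore depends continuously on that point.\<close>

lemma bij_explicit_flow:
  assumes "k \<noteq> 0" and diff: "\<And>\<alpha>. U0 differentiable (at \<alpha>)" and "subcritical k U0"
    and cont: "continuous_on UNIV u"
    and u: "\<And>\<alpha>. u (explicit_flow k U0 t \<alpha>) = rotation (2 * k * t) (U0 \<alpha>)"
  shows "bij (explicit_flow k U0 t)"
proof -
  let ?F = "explicit_flow k U0 t"
  \<comment> \<open>Rotating the velocity back recovers the initial velocity of the particle at x.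
    Solving the explicit formula for the label then gives \<open>P\<close>, a continuous left
    inverse of the flow map.\<close>
  define V where "V x = rotation (- (2 * k * t)) (u x)" for x
  define P where "P x = x - (1 / (2 * k)) *\<^sub>R
     (sin (2 * k * t) *\<^sub>R V x + (1 - cos (2 * k * t)) *\<^sub>R (J *v V x))" for x
  have inj: "inj ?F"
    by (rule inj_explicit_flow[OF assms(1-3)])
  have cont_J: "continuous_on UNIV (\<lambda>x. J *v f x)" if "continuous_on UNIV f" for f :: "real^2 \<Rightarrow> real^2"
    by (rule bounded_linear.continuous_on[OF matrix_vector_mul_bounded_linear that])
  have cont_V: "continuous_on UNIV V"
    unfolding V_def rotation_def by (intro continuous_intros cont cont_J)
  have cont_P: "continuous_on UNIV P"
    unfolding P_def by (intro continuous_intros cont_V cont_J)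
  have cont_F: "continuous_on UNIV ?F"
    using has_derivative_explicit_flow[OF diff] has_derivative_continuous
    by (blast intro: continuous_at_imp_continuous_on)
  have "V (?F \<alpha>) = U0 \<alpha>" for \<alpha>
    by (simp add: V_def u)
  then have "P (?F \<alpha>) = \<alpha>" for \<alpha>
    by (simp add: P_def explicit_flow_eq)
  then have "range ?F = {x. ?F (P x) = x}"
    by (auto simp: image_iff) metis
  moreover have "closed {x. ?F (P x) = x}"
    by (intro closed_Collect_eq continuous_on_id continuous_on_compose2[OF cont_F cont_P]) auto
  moreover have "open (range ?F)"
    using invariance_of_domain[OF cont_F open_UNIV inj] .
  \<comment> \<open>The plane is connected and the range is nonempty, open and closed.\<close>
  ultimately have "range ?F = UNIV"
    using clopen[of "range ?F"] by auto
  with inj show ?thesis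
    by (simp add: bij_def)
qed

lemma solves_continuous_on_slice:
  assumes "solves k U0 D U" "{t} \<times> UNIV \<subseteq> D"
  shows "continuous_on UNIV (U t)"
proof -
  have "continuous_on D (\<lambda>(s, y). U s y)"
    unfolding continuous_on_eq_continuous_within
    using assms(1) by (fastforce simp: solves_def intro: has_derivative_continuous)
  then have "continuous_on UNIV (\<lambda>y. (\<lambda>(s, y). U s y) (t, y))"
    by (rule continuous_on_compose2) (use assms(2) in \<open>auto intro!: continuous_intros\<close>)
  then show ?thesis by simp
qed

text \<open>For the explicit formula itself, invertibility means injectivity with open range and
  differentiable inverse. Surjectivity is drawn from a velocity field continuous on the whole plane,
  hence the condition \<open>I \<times> UNIV \<subseteq> D\<close>. An interval I admits solutions
  that live only for a limited time, so periodicity compares times that both lie in I. The existence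
  clause shows that for sub-critical data such solutions and flows do occur, for all times.\<close>

theorem theorem1p2:
  fixes k :: real and U0 :: "real^2 \<Rightarrow> real^2"
  assumes "k > 0"
    and "\<forall>\<alpha>. U0 differentiable (at \<alpha>)"
  shows
    "(\<forall>I D U X. is_interval I \<and> 0 \<in> I \<and> solves k U0 D U \<and> flow_map I D U X \<longrightarrow>
        (\<forall>t\<in>I. \<forall>\<alpha>.
           ((\<lambda>s. U s (X s \<alpha>)) has_vector_derivative (2 * k) *\<^sub>R (J *v U t (X t \<alpha>))) (at t within I) \<and>
           X t \<alpha> = explicit_flow k U0 t \<alpha>))
     \<and>
     (subcritical k U0 \<longrightarrow>
        (\<forall>t. inj (explicit_flow k U0 t) \<and>
             open (range (explicit_flow k U0 t)) \<and>
             inv (explicit_flow k U0 t) differentiable_on range (explicit_flow k U0 t)) \<and>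
        (\<forall>t. explicit_flow k U0 (t + pi / k) = explicit_flow k U0 t) \<and>
        (\<exists>U. open (swept_region (explicit_flow k U0)) \<and>
             solves k U0 (swept_region (explicit_flow k U0)) U \<and>
             flow_map UNIV (swept_region (explicit_flow k U0)) U (explicit_flow k U0) \<and>
             (\<forall>t \<alpha>. U t (explicit_flow k U0 t \<alpha>)
                      = U0 \<alpha> + (2 * k) *\<^sub>R (J *v (explicit_flow k U0 t \<alpha> - \<alpha>))) \<and>
             (\<forall>t \<alpha>. U (t + pi / k) (explicit_flow k U0 (t + pi / k) \<alpha>)
                      = U t (explicit_flow k U0 t \<alpha>))) \<and>
        (\<forall>I D U X. is_interval I \<and> 0 \<in> I \<and> solves k U0 D U \<and> flow_map I D U X \<longrightarrow>
           (I \<times> UNIV \<subseteq> D \<longrightarrow> (\<forall>t\<in>I. bij (X t))) \<and>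
           (\<forall>t\<in>I. \<forall>\<alpha>.
              U t (X t \<alpha>) = U0 \<alpha> + (2 * k) *\<^sub>R (J *v (X t \<alpha> - \<alpha>)) \<and>
              (t + pi / k \<in> I \<longrightarrow>
                 X (t + pi / k) \<alpha> = X t \<alpha> \<and>
                 U (t + pi / k) (X (t + pi / k) \<alpha>) = U t (X t \<alpha>)))))"
  (is "?dynamics \<and> (subcritical k U0 \<longrightarrow> ?invertible \<and> ?periodic \<and> ?solution \<and> ?flows)")
proof (intro conjI impI)
  have k: "k \<noteq> 0"
    using \<open>k > 0\<close> by simp
  have diff: "U0 differentiable (at \<alpha>)" for \<alpha>
    using assms by blast
  show ?dynamics
    using has_vector_derivative_along_flow flow_map_eq_explicit_flow[OF k] by blast
  assume sub: "subcritical k U0"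
  show ?invertible
  proof
    fix t
    note inj = inj_explicit_flow[OF k diff sub, where t = t]
    note inv = inj_has_derivative_inv[OF inj has_derivative_explicit_flow[OF diff]
        inj_derivative_explicit_flow[OF k sub]]
    have "inv (explicit_flow k U0 t) differentiable_on range (explicit_flow k U0 t)"
      unfolding differentiable_on_def
      using inv(2) by (blast intro: differentiable_at_withinI differentiableI)
    with inj inv(1) show "inj (explicit_flow k U0 t) \<and> open (range (explicit_flow k U0 t)) \<and>
        inv (explicit_flow k U0 t) differentiable_on range (explicit_flow k U0 t)"
      by blast
  qed
  show ?periodic
    using explicit_flow_periodic[OF k] by blast
  have velocity_periodic: "rotation (2 * k * (t + pi / k)) w = rotation (2 * k * t) w" for t w
    using k by (simp add: rotation_def distrib_left)
  show ?solution
  proof -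
    obtain U where sol: "solves k U0 (swept_region (explicit_flow k U0)) U"
      and U: "\<And>t \<alpha>. U t (explicit_flow k U0 t \<alpha>) = rotation (2 * k * t) (U0 \<alpha>)"
      using subcritical_solution_exists[OF k diff sub] by blast
    have "open (swept_region (explicit_flow k U0))"
      unfolding swept_region_eq_range by (rule explicit_flow_spacetime_inverse(2)[OF k diff sub])
    moreover have "flow_map UNIV (swept_region (explicit_flow k U0)) U (explicit_flow k U0)"
      using has_vector_derivative_explicit_flow[OF k] by (auto simp: flow_map_def swept_region_def U)
    ultimately show ?thesis
      using sol by (intro exI[of _ U]) (simp add: U explicit_flow_velocity[OF k] velocity_periodic)
  qed
  show ?flows
  proof (intro allI impI, elim conjE, intro conjI impI ballI allI)
    fix I D U X
    assume I: "is_interval I" "0 \<in> I" and sol: "solves k U0 D U" and flow: "flow_map I D U X"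
    note vel = flow_map_velocity[OF k I _ sol flow]
    note X = flow_map_eq_explicit_flow[OF k I _ sol flow]
    fix t assume t: "t \<in> I"
    show "bij (X t)" if "I \<times> UNIV \<subseteq> D"
    proof -
      have "continuous_on UNIV (U t)"
        using that t by (intro solves_continuous_on_slice[OF sol]) auto
      moreover have "U t (explicit_flow k U0 t \<alpha>) = rotation (2 * k * t) (U0 \<alpha>)" for \<alpha>
        using vel[OF t, of \<alpha>] X[OF t, of \<alpha>] by simp
      ultimately have "bij (explicit_flow k U0 t)"
        by (rule bij_explicit_flow[OF k diff sub])
      moreover have "X t = explicit_flow k U0 t"
        using X[OF t] by blast
      ultimately show ?thesis by simp
    qed
    fix \<alpha>
    show "U t (X t \<alpha>) = U0 \<alpha> + (2 * k) *\<^sub>R (J *v (X t \<alpha> - \<alpha>))"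
      using vel[OF t, of \<alpha>] X[OF t, of \<alpha>] by (simp add: explicit_flow_velocity[OF k])
    assume t': "t + pi / k \<in> I"
    show "X (t + pi / k) \<alpha> = X t \<alpha>"
      by (simp add: X[OF t] X[OF t'] explicit_flow_periodic[OF k])
    show "U (t + pi / k) (X (t + pi / k) \<alpha>) = U t (X t \<alpha>)"
      by (simp only: vel[OF t] vel[OF t'] velocity_periodic)
  qed
qed

end
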